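(* Let $G$ be a Dehn-Sommerville $q$-variety with vertex set $V(G)$, let $k\ge 1$, $A_k=\{0,1,\dots,k\}$, and let $g:V(G)\to A_k$ be an arbitrary function. Extend $g$ to $G$ by $g(x)=\{g(v): v\in x\}$ and put $G_g=\{x\in G: g(x)=A_k\}$. If $G_g$ is non-empty, then $G_g$ is a Dehn-Sommerville $(q-k)$-variety.
   Context: A finite abstract simplicial complex $G$ is a finite set of non-empty finite sets closed under taking non-empty subsets; its vertices are its one-element sets. The star of $x\in G$ is $U(x)=\{y\in G: x\subset y\}$, $\overline{U(x)}=\{z\in G: z\subset y\text{ for some }y\in U(x)\}$, and the unit sphere is $S(x)=\overline{U(x)}\setminus U(x)$. The empty complex is the Dehn-Sommerville $(-1)$-variety; inductively, for $q\ge0$, a non-empty complex is a Dehn-Sommerville $q$-variety if every unit sphere $S(x)$ is a Dehn-Sommerville $(q-1)$-variety. Graph version: for a finite simple graph, the unit sphere of a vertex is the subgraph induced by its neighbours; the empty graph is the Dehn-Sommerville $(-1)$-variety graph and, for $q\ge 0$, a non-empty graph is a Dehn-Sommerville $q$-variety graph if every unit sphere is a Dehn-Sommerville $(q-1)$-variety graph. A subset $U\subset G$ is called a Dehn-Sommerville $m$-variety if the graph with vertex set $U$ and edges $\{x,y\}$ for distinct $x,y\in U$ with $x\subset y$ or $y\subset x$ is a Dehn-Sommerville $m$-variety graph. *)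

theory Defs
  imports "HOL-Library.FuncSet"
begin

definition simplicial_complex :: "'a set set \<Rightarrow> bool" where
  "simplicial_complex G \<longleftrightarrow>
     finite G \<and> (\<forall>x\<in>G. finite x \<and> x \<noteq> {}) \<and> (\<forall>x\<in>G. \<forall>y. y \<subseteq> x \<and> y \<noteq> {} \<longrightarrow> y \<in> G)"

text \<open>A vertex, i.e. a one-element set \<open>{v}\<close> of the complex, is identified with the point \<open>v\<close>.\<close>

definition complex_vertices :: "'a set set \<Rightarrow> 'a set" where
  "complex_vertices G = {v. {v} \<in> G}"

definition star :: "'a set set \<Rightarrow> 'a set \<Rightarrow> 'a set set" where
  "star G x = {y \<in> G. x \<subseteq> y}"

definition star_closure :: "'a set set \<Rightarrow> 'a set \<Rightarrow> 'a set set" where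
  "star_closure G x = {z \<in> G. \<exists>y \<in> star G x. z \<subseteq> y}"

definition unit_sphere :: "'a set set \<Rightarrow> 'a set \<Rightarrow> 'a set set" where
  "unit_sphere G x = star_closure G x - star G x"

inductive DS_complex :: "int \<Rightarrow> 'a set set \<Rightarrow> bool" where
  empty: "DS_complex (-1) {}"
| step: "\<lbrakk>q \<ge> 0; simplicial_complex G; G \<noteq> {}; \<forall>x\<in>G. DS_complex (q - 1) (unit_sphere G x)\<rbrakk>
           \<Longrightarrow> DS_complex q G"

text \<open>A simple graph is a pair of a vertex set and a set of two-element sets of vertices.\<close>

type_synonym 'v graph = "'v set \<times> 'v set set"

definition finite_simple_graph :: "'v graph \<Rightarrow> bool" where
  "finite_simple_graph \<Gamma> \<longleftrightarrow>
     finite (fst \<Gamma>) \<and> (\<forall>e \<in> snd \<Gamma>. e \<subseteq> fst \<Gamma> \<and> card e = 2)"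

definition induced_subgraph :: "'v graph \<Rightarrow> 'v set \<Rightarrow> 'v graph" where
  "induced_subgraph \<Gamma> W = (fst \<Gamma> \<inter> W, {e \<in> snd \<Gamma>. e \<subseteq> W})"

definition neighbours :: "'v graph \<Rightarrow> 'v \<Rightarrow> 'v set" where
  "neighbours \<Gamma> v = {w \<in> fst \<Gamma>. {v, w} \<in> snd \<Gamma>}"

definition graph_unit_sphere :: "'v graph \<Rightarrow> 'v \<Rightarrow> 'v graph" where
  "graph_unit_sphere \<Gamma> v = induced_subgraph \<Gamma> (neighbours \<Gamma> v)"

inductive DS_graph :: "int \<Rightarrow> 'v graph \<Rightarrow> bool" where
  empty: "DS_graph (-1) ({}, {})"
| step: "\<lbrakk>q \<ge> 0; finite_simple_graph \<Gamma>; fst \<Gamma> \<noteq> {};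
          \<forall>v \<in> fst \<Gamma>. DS_graph (q - 1) (graph_unit_sphere \<Gamma> v)\<rbrakk>
           \<Longrightarrow> DS_graph q \<Gamma>"

definition inclusion_graph :: "'a set set \<Rightarrow> 'a set graph" where
  "inclusion_graph U =
     (U, {{x, y} | x y. x \<in> U \<and> y \<in> U \<and> x \<noteq> y \<and> (x \<subseteq> y \<or> y \<subseteq> x)})"

definition DS_subset :: "int \<Rightarrow> 'a set set \<Rightarrow> bool" where
  "DS_subset m U \<longleftrightarrow> DS_graph m (inclusion_graph U)"

definition level_set :: "'a set set \<Rightarrow> ('a \<Rightarrow> nat) \<Rightarrow> nat \<Rightarrow> 'a set set" where
  "level_set G g k = {x \<in> G. g ` x = {0..k}}"

end

theory Submission
  imports Defs
begin

text \<open>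
  A Dehn-Sommerville \<open>q\<close>-variety is pure: every simplex lies in one with \<open>q + 1\<close> vertices, and no
  simplex has more. Conversely, the comparability graph of a finite family of sets is a
  Dehn-Sommerville \<open>m\<close>-variety as soon as all maximal chains of the family have \<open>m + 1\<close> elements,
  since adjoining \<open>x\<close> to a maximal chain in the unit sphere of \<open>x\<close> gives a maximal chain. Along a
  maximal chain in \<open>G\<^sub>g\<close> the cardinality takes each value from \<open>k + 1\<close> (one vertex of each colour)
  to \<open>q + 1\<close> exactly once, which gives \<open>q - k + 1\<close> elements.
\<close>

section \<open>Links of vertices and purity\<close>

lemma simplicial_complex_face:
  "simplicial_complex G \<Longrightarrow> x \<in> G \<Longrightarrow> y \<subseteq> x \<Longrightarrow> y \<noteq> {} \<Longrightarrow> y \<in> G"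
  unfolding simplicial_complex_def by metis

text \<open>Together with \<open>unit_sphere_vertexD\<close> this identifies the unit sphere of a
  vertex with its link, so removing and adding \<open>v\<close> translates between simplices through
  \<open>v\<close> and simplices of the sphere.\<close>

lemma mem_unit_sphere_vertex:
  assumes "simplicial_complex G" "insert v w \<in> G" "v \<notin> w" "w \<noteq> {}"
  shows "w \<in> unit_sphere G {v}"
proof -
  have "w \<in> G"
    using simplicial_complex_face[OF assms(1,2)] assms(4) by blast
  then show ?thesis
    using assms by (auto simp: unit_sphere_def star_closure_def star_def)
qed

lemma unit_sphere_vertexD:
  assumes "simplicial_complex G" "w \<in> unit_sphere G {v}"
  shows "v \<notin> w" "insert v w \<in> G"
proof -
  from assms(2) obtain y where "w \<in> G" "y \<in> G" "v \<in> y" "w \<subseteq> y" and v: "v \<notin> w"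
    by (auto simp: unit_sphere_def star_closure_def star_def)
  then have "insert v w \<subseteq> y"
    by simp
  with \<open>y \<in> G\<close> show "insert v w \<in> G"
    using simplicial_complex_face[OF assms(1)] by blast
  show "v \<notin> w" by (fact v)
qed

lemma DS_complex_simplicial:
  assumes "DS_complex q G"
  shows "simplicial_complex G"
  using assms
proof cases
  case empty
  then show ?thesis by (simp add: simplicial_complex_def)
qed

text \<open>Induction through the link of a vertex \<open>v\<close> of \<open>z\<close>: removing
  \<open>v\<close> lowers the size of \<open>z\<close> by one, and adding \<open>v\<close> to a
  simplex of size \<open>q\<close> in the link gives one of size \<open>q + 1\<close> in
  \<open>G\<close>.\<close>

lemma DS_complex_pure:
  assumes "DS_complex q G" "z \<in> G"
  shows "int (card z) \<le> q + 1 \<and> (\<exists>y\<in>G. z \<subseteq> y \<and> int (card y) = q + 1)"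
  using assms
proof (induction arbitrary: z rule: DS_complex.induct)
  case empty
  then show ?case by simp
next
  case (step q G)
  note sc = \<open>simplicial_complex G\<close>
  from sc \<open>z \<in> G\<close> have fin: "finite z" and "z \<noteq> {}"
    by (auto simp: simplicial_complex_def)
  then obtain v where v: "v \<in> z" by blast
  define S where "S = unit_sphere G {v}"
  have vG: "{v} \<in> G"
    using v by (intro simplicial_complex_face[OF sc \<open>z \<in> G\<close>]) auto
  have IH: "int (card w) \<le> q \<and> (\<exists>y\<in>S. w \<subseteq> y \<and> int (card y) = q)" if "w \<in> S" for w
    using bspec[OF step.IH vG] that unfolding S_def by simp
  have DS: "DS_complex (q - 1) S"
    using bspec[OF step.IH vG] unfolding S_def by simp
  have cone: "insert v y \<in> G \<and> int (card (insert v y)) = q + 1"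
    if "y \<in> S" "int (card y) = q" for y
  proof -
    have "v \<notin> y" "insert v y \<in> G"
      using unit_sphere_vertexD[OF sc] that(1) unfolding S_def by auto
    moreover have "finite y"
      using sc \<open>insert v y \<in> G\<close> unfolding simplicial_complex_def
      by (metis finite_insert)
    ultimately show ?thesis using that(2) by simp
  qed
  show ?case
  proof (cases "z = {v}")
    case False
    with v have "z - {v} \<in> S"
      unfolding S_def using sc \<open>z \<in> G\<close>
      by (intro mem_unit_sphere_vertex) (auto simp: insert_absorb)
    from IH[OF this] obtain y where y: "y \<in> S" "z - {v} \<subseteq> y" "int (card y) = q"
      and "int (card (z - {v})) \<le> q" by blast
    moreover have "card z = Suc (card (z - {v}))"
      using fin v by (rule card.remove)
    moreover have "z \<subseteq> insert v y" using y by auto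
    ultimately show ?thesis using cone[of y] by auto
  next
    case True
    \<comment> \<open>Here \<open>z - {v}\<close> is empty, hence no simplex of \<open>S\<close>.
      Either \<open>S\<close> is empty, so that \<open>q = 0\<close> and \<open>{v}\<close> already
      has full size, or any simplex of \<open>S\<close> starts the argument.\<close>
    from DS show ?thesis
    proof (cases rule: DS_complex.cases)
      case empty
      then show ?thesis using True vG by auto
    next
      case step
      then obtain w where "w \<in> S" by blast
      from IH[OF this] obtain y where "y \<in> S" "int (card y) = q" by blast
      with cone[of y] True \<open>q \<ge> 0\<close> show ?thesis by auto
    qed
  qed
qed

section \<open>Comparability graphs and maximal chains\<close>

text \<open>This keeps the recursion on graphs within families of sets, where chains can be
  used.\<close>

lemma graph_unit_sphere_inclusion_graph:
  assumes "x \<in> U"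
  shows "graph_unit_sphere (inclusion_graph U) x =
    inclusion_graph {y \<in> U. y \<noteq> x \<and> (x \<subseteq> y \<or> y \<subseteq> x)}"
proof -
  let ?S = "{y \<in> U. y \<noteq> x \<and> (x \<subseteq> y \<or> y \<subseteq> x)}"
  have "neighbours (inclusion_graph U) x = ?S"
    unfolding neighbours_def inclusion_graph_def fst_conv snd_conv mem_Collect_eq doubleton_eq_iff
    using assms by blast
  moreover have "induced_subgraph (inclusion_graph U) W = inclusion_graph W" if "W \<subseteq> U" for W
  proof -
    have "{e \<in> snd (inclusion_graph U). e \<subseteq> W} = snd (inclusion_graph W)"
    proof (intro set_eqI iffI)
      fix e assume "e \<in> {e \<in> snd (inclusion_graph U). e \<subseteq> W}"
      then obtain a b where "e = {a, b}" "e \<subseteq> W" "a \<noteq> b" "a \<subseteq> b \<or> b \<subseteq> a"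
        unfolding inclusion_graph_def snd_conv mem_Collect_eq by metis
      then have "a \<in> W" "b \<in> W" by simp_all
      with \<open>e = {a, b}\<close> \<open>a \<noteq> b\<close> \<open>a \<subseteq> b \<or> b \<subseteq> a\<close>
      show "e \<in> snd (inclusion_graph W)"
        unfolding inclusion_graph_def snd_conv mem_Collect_eq by metis
    next
      fix e assume "e \<in> snd (inclusion_graph W)"
      then obtain a b where e: "e = {a, b}" "a \<in> W" "b \<in> W" "a \<noteq> b" "a \<subseteq> b \<or> b \<subseteq> a"
        unfolding inclusion_graph_def snd_conv mem_Collect_eq by metis
      moreover have "a \<in> U" "b \<in> U"
        using e(2,3) that by (simp_all add: subsetD)
      ultimately show "e \<in> {e \<in> snd (inclusion_graph U). e \<subseteq> W}"
        unfolding inclusion_graph_def snd_conv mem_Collect_eq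
        by (metis empty_subsetI insert_subset)
    qed
    moreover have "U \<inter> W = W"
      using that by blast
    ultimately show ?thesis
      by (simp add: induced_subgraph_def inclusion_graph_def)
  qed
  moreover have "?S \<subseteq> U" by blast
  ultimately show ?thesis
    by (simp add: graph_unit_sphere_def)
qed

lemma finite_simple_inclusion_graph:
  "finite U \<Longrightarrow> finite_simple_graph (inclusion_graph U)"
  unfolding finite_simple_graph_def inclusion_graph_def fst_conv snd_conv
  by (intro conjI ballI, assumption) (elim CollectE exE conjE; simp add: card_insert_if)+

text \<open>A chain of \<open>U\<close> strictly larger than \<open>insert x C\<close> contains
  \<open>x\<close>, so its other members are comparable to \<open>x\<close>; removing
  \<open>x\<close> leaves a chain that strictly extends \<open>C\<close> among those sets.\<close>

lemma maxchain_insert_comparable: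
  assumes "x \<in> U" "subset.maxchain {y \<in> U. y \<noteq> x \<and> (x \<subseteq> y \<or> y \<subseteq> x)} C"
  shows "subset.maxchain U (insert x C)"
proof -
  let ?S = "{y \<in> U. y \<noteq> x \<and> (x \<subseteq> y \<or> y \<subseteq> x)}"
  from assms(2) have C: "subset.chain ?S C" and max: "\<And>D. subset.chain ?S D \<Longrightarrow> \<not> C \<subset> D"
    by (auto simp: subset.maxchain_def)
  have "subset.chain U (insert x C)"
    using C assms(1) unfolding subset_chain_def by blast
  moreover have False if D: "subset.chain U D" "insert x C \<subset> D" for D
  proof -
    have "subset.chain ?S (D - {x})"
      using D unfolding subset_chain_def by blast
    moreover have "x \<notin> C"
      using C by (auto simp: subset_chain_def)
    then have "C \<subset> D - {x}"
      using D(2) by blast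
    ultimately show False using max by blast
  qed
  ultimately show ?thesis
    by (auto simp: subset.maxchain_def)
qed

lemma DS_subset_if_maxchain_card:
  assumes "finite U" "\<And>C. subset.maxchain U C \<Longrightarrow> card C = n"
  shows "DS_subset (int n - 1) U"
  using assms
proof (induction n arbitrary: U)
  case 0
  obtain C where C: "subset.maxchain U C"
    using subset.Hausdorff by blast
  then have "C \<subseteq> U"
    by (auto simp: subset.maxchain_def subset_chain_def)
  \<comment> \<open>Infinite sets have \<open>card\<close> 0 as well; \<open>C\<close> is finite as
    a subset of \<open>U\<close>.\<close>
  with C 0 have "C = {}"
    by (metis card_0_eq finite_subset)
  have "U = {}"
  proof (rule ccontr)
    assume "U \<noteq> {}"
    then obtain x where "subset.chain U {x}"
      by (auto simp: subset_chain_def)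
    with C \<open>C = {}\<close> show False
      by (auto simp: subset.maxchain_def)
  qed
  then show ?case
    by (simp add: DS_subset_def inclusion_graph_def DS_graph.empty)
next
  case (Suc n)
  have "U \<noteq> {}"
  proof
    \<comment> \<open>In an empty family the empty chain is maximal, and its size is not
      \<open>Suc n\<close>.\<close>
    assume "U = {}"
    then have "subset.maxchain U {}"
      by (auto simp: subset.maxchain_def subset_chain_def)
    from Suc.prems(2)[OF this] show False by simp
  qed
  have "DS_graph (int n - 1) (graph_unit_sphere (inclusion_graph U) x)" if x: "x \<in> U" for x
  proof -
    let ?S = "{y \<in> U. y \<noteq> x \<and> (x \<subseteq> y \<or> y \<subseteq> x)}"
    have "card C = n" if C: "subset.maxchain ?S C" for C
    proof -
      have "C \<subseteq> ?S"
        using C by (auto simp: subset.maxchain_def subset_chain_def)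
      then have "x \<notin> C" "finite C"
        using Suc.prems(1) by (auto intro: finite_subset)
      then show ?thesis
        using Suc.prems(2)[OF maxchain_insert_comparable[OF x C]] by simp
    qed
    with Suc.prems(1) have "DS_subset (int n - 1) ?S"
      by (intro Suc.IH) auto
    then show ?thesis
      by (simp add: graph_unit_sphere_inclusion_graph[OF x] DS_subset_def)
  qed
  moreover have "fst (inclusion_graph U) = U"
    by (simp add: inclusion_graph_def)
  ultimately have "DS_graph (int n) (inclusion_graph U)"
    using \<open>U \<noteq> {}\<close> finite_simple_inclusion_graph[OF Suc.prems(1)] by (intro DS_graph.step) simp_all
  then show ?case
    by (simp add: DS_subset_def)
qed

section \<open>Sizes along a maximal chain\<close>

lemma inj_on_card_chain:
  assumes "subset.chain U C" "\<And>x. x \<in> C \<Longrightarrow> finite x"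
  shows "inj_on card C"
proof (rule inj_onI)
  fix x y assume xy: "x \<in> C" "y \<in> C" "card x = card y"
  then have "x \<subseteq> y \<or> y \<subseteq> x"
    using assms(1) by (auto simp: subset_chain_def)
  then show "x = y"
    using assms(2) xy by (metis card_subset_eq)
qed

lemma subset_chain_less_card:
  assumes "subset.chain U C" "\<And>x. x \<in> C \<Longrightarrow> finite x" "x \<in> C" "y \<in> C" "card x < card y"
  shows "x \<subseteq> y"
proof -
  have "\<not> y \<subseteq> x"
    using card_mono[OF assms(2)[OF assms(3)]] assms(5) leD by blast
  then show ?thesis
    using assms(1,3,4) by (auto simp: subset_chain_def)
qed

text \<open>If \<open>C\<close> skipped the size \<open>j\<close>, a set of size \<open>j\<close>
  could be fitted between its smaller and its larger members, against maximality. Convexity puts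
  that set into \<open>U\<close>; \<open>lower\<close> and \<open>upper\<close> supply a bound on a
  side where \<open>C\<close> has no member.\<close>

lemma maxchain_card_surj:
  assumes max: "subset.maxchain U C" and fin: "finite U" "\<And>x. x \<in> U \<Longrightarrow> finite x"
    and conv: "\<And>x y z. x \<in> U \<Longrightarrow> z \<in> U \<Longrightarrow> x \<subseteq> y \<Longrightarrow> y \<subseteq> z \<Longrightarrow> y \<in> U"
    and lower: "\<And>x. x \<in> U \<Longrightarrow> \<exists>y\<in>U. y \<subseteq> x \<and> card y = a"
    and upper: "\<And>x. x \<in> U \<Longrightarrow> \<exists>y\<in>U. x \<subseteq> y \<and> card y = b"
    and "U \<noteq> {}" "a \<le> j" "j \<le> b"
  shows "j \<in> card ` C"
proof (rule ccontr)
  assume nj: "j \<notin> card ` C"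
  from max have C: "subset.chain U C" and maxC: "\<And>D. subset.chain U D \<Longrightarrow> \<not> C \<subset> D"
    by (auto simp: subset.maxchain_def)
  have CU: "C \<subseteq> U" using C by (auto simp: subset_chain_def)
  then have "finite C" and finC: "\<And>x. x \<in> C \<Longrightarrow> finite x"
    using fin by (auto intro: finite_subset)
  define A where "A = {x \<in> C. card x < j}"
  define B where "B = {x \<in> C. j < card x}"
  have "C = A \<union> B"
    using nj by (force simp: A_def B_def)
  have chA: "subset.chain U A" and chB: "subset.chain U B" and "finite A" "finite B"
    using C \<open>finite C\<close> by (auto simp: A_def B_def subset_chain_def)
  have AB: "x \<subseteq> y" if "x \<in> A" "y \<in> B" for x y
    using that by (intro subset_chain_less_card[OF C finC]) (auto simp: A_def B_def)
  \<comment> \<open>The upper bound \<open>H\<close> is the least member of \<open>B\<close>, or, if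
    \<open>B\<close> is empty, a set of size \<open>b\<close> above all of \<open>A\<close>.\<close>
  have "\<exists>H\<in>U. j \<le> card H \<and> (\<forall>x\<in>A. x \<subseteq> H) \<and> (\<forall>x\<in>B. H \<subseteq> x)"
  proof (cases "B = {}")
    case False
    then have "\<Inter>B \<in> B"
      using \<open>finite B\<close> chB by (intro Inter_in_chain)
    then show ?thesis
      using CU AB by (intro bexI[of _ "\<Inter>B"]) (auto simp: B_def)
  next
    case B: True
    have "\<exists>x\<in>U. \<Union>A \<subseteq> x"
    proof (cases "A = {}")
      case False
      then have "\<Union>A \<in> A"
        using \<open>finite A\<close> chA by (intro Union_in_chain)
      then show ?thesis using CU by (auto simp: A_def)
    qed (use \<open>U \<noteq> {}\<close> in auto)
    then show ?thesis
      using B upper \<open>j \<le> b\<close> by (metis Sup_le_iff empty_iff order_trans)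
  qed
  then obtain H where H: "H \<in> U" "j \<le> card H" "\<forall>x\<in>A. x \<subseteq> H" "\<forall>x\<in>B. H \<subseteq> x"
    by blast
  \<comment> \<open>The lower bound \<open>L\<close> is the largest member of \<open>A\<close>, or,
    if \<open>A\<close> is empty, a set of size \<open>a\<close> chosen inside \<open>H\<close>, so
    that a set of size \<open>j\<close> fits between \<open>L\<close> and \<open>H\<close>.\<close>
  have "\<exists>L\<in>U. L \<subseteq> H \<and> card L \<le> j \<and> (\<forall>x\<in>A. x \<subseteq> L)"
  proof (cases "A = {}")
    case False
    then have "\<Union>A \<in> A"
      using \<open>finite A\<close> chA by (intro Union_in_chain)
    then show ?thesis
      using CU H(3) by (intro bexI[of _ "\<Union>A"]) (auto simp: A_def)
  next
    case True
    then show ?thesis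
      using lower[OF H(1)] \<open>a \<le> j\<close> by auto
  qed
  then obtain L where L: "L \<in> U" "L \<subseteq> H" "card L \<le> j" "\<forall>x\<in>A. x \<subseteq> L"
    by blast
  obtain y where y: "L \<subseteq> y" "y \<subseteq> H" "card y = j"
    using exists_subset_between[OF L(3) H(2) L(2) fin(2)[OF H(1)]] by blast
  have "y \<in> U"
    using conv L(1) H(1) y by blast
  moreover have "x \<subseteq> y \<or> y \<subseteq> x" if "x \<in> C" for x
    using that \<open>C = A \<union> B\<close> H L y by blast
  ultimately have "subset.chain U (insert y C)"
    using C unfolding subset_chain_def by blast
  moreover have "y \<notin> C" using nj y(3) by blast
  ultimately show False using maxC by blast
qed

section \<open>Colours and sizes in the level set\<close>

theorem mainTheorem3:
  fixes G :: "'a set set" and g :: "'a \<Rightarrow> nat" and q :: int and k :: nat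
  assumes "DS_complex q G"
    and "k \<ge> 1"
    and "g \<in> complex_vertices G \<rightarrow> {0..k}"
    and "level_set G g k \<noteq> {}"
  shows "DS_subset (q - int k) (level_set G g k)"
proof -
  define U where "U = level_set G g k"
  have sc: "simplicial_complex G"
    using assms(1) by (rule DS_complex_simplicial)
  have mem_U: "x \<in> U \<longleftrightarrow> x \<in> G \<and> g ` x = {0..k}" for x
    by (simp add: U_def level_set_def)
  have finU: "finite U" and finx: "\<And>x. x \<in> U \<Longrightarrow> finite x"
    using sc by (auto simp: mem_U simplicial_complex_def U_def level_set_def)
  have down: "y \<in> G" if "x \<in> G" "y \<subseteq> x" "y \<noteq> {}" for x y
    using sc that by (rule simplicial_complex_face)
  \<comment> \<open>A simplex of \<open>G\<close> above \<open>x\<close> already shows all colours,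
    and its vertices have no colours outside \<open>{0..k}\<close>.\<close>
  have up: "y \<in> U" if "x \<in> U" "x \<subseteq> y" "y \<in> G" for x y
  proof -
    have "g ` y \<subseteq> {0..k}"
      using assms(3) down[OF \<open>y \<in> G\<close>] by (auto simp: complex_vertices_def Pi_iff)
    moreover have "g ` x \<subseteq> g ` y"
      using that(2) by (rule image_mono)
    ultimately show ?thesis
      using that by (simp add: mem_U)
  qed
  have conv: "y \<in> U" if "x \<in> U" "z \<in> U" "x \<subseteq> y" "y \<subseteq> z" for x y z
    using that by (intro up[of x y] down[of z y]) (auto simp: mem_U)
  have lower: "\<exists>y\<in>U. y \<subseteq> x \<and> card y = k + 1" if x: "x \<in> U" for x
  proof -
    \<comment> \<open>Choose one vertex of \<open>x\<close> for each colour.\<close>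
    obtain y where y: "y \<subseteq> x" "inj_on g y" "g ` x = g ` y"
      using subset_image_inj[of "g ` x" g x] by auto
    then have "g ` y = {0..k}"
      using x by (simp add: mem_U)
    then have "card y = k + 1" "y \<noteq> {}"
      using card_image[OF y(2)] by auto
    then show ?thesis
      using x y down[of x y] by (auto simp: mem_U)
  qed
  define b where "b = nat (q + 1)"
  have pure: "int (card x) \<le> q + 1" "\<exists>y\<in>G. x \<subseteq> y \<and> int (card y) = q + 1" if "x \<in> U" for x
    using DS_complex_pure[OF assms(1)] that by (auto simp: mem_U)
  have upper: "\<exists>y\<in>U. x \<subseteq> y \<and> card y = b" if x: "x \<in> U" for x
    using pure(2)[OF x] up[OF x] unfolding b_def by (metis nat_int)
  have range: "card x \<in> {k + 1..b}" if x: "x \<in> U" for x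
  proof -
    obtain y where "y \<subseteq> x" "card y = k + 1"
      using lower[OF x] by blast
    then have "k + 1 \<le> card x"
      using card_mono[OF finx[OF x]] by metis
    then show ?thesis using pure(1)[OF x] by (auto simp: b_def)
  qed
  have "U \<noteq> {}" using assms(4) by (simp add: U_def)
  have "card C = b - k" if C: "subset.maxchain U C" for C
  proof -
    have ch: "subset.chain U C" and CU: "C \<subseteq> U"
      using C by (auto simp: subset.maxchain_def subset_chain_def)
    \<comment> \<open>With \<open>range\<close> and injectivity of \<open>card\<close> on
      \<open>C\<close>, the members of \<open>C\<close> correspond to the \<open>b - k\<close> sizes
      from \<open>k + 1\<close> to \<open>b\<close>.\<close>
    have "{k + 1..b} \<subseteq> card ` C"
      using maxchain_card_surj[OF C finU finx conv lower upper \<open>U \<noteq> {}\<close>] by auto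
    with range CU have "card ` C = {k + 1..b}" by blast
    moreover have "inj_on card C"
      using inj_on_card_chain[OF ch] finx CU by blast
    ultimately show ?thesis
      using card_image[of card C] by simp
  qed
  with finU have "DS_subset (int (b - k) - 1) U"
    by (rule DS_subset_if_maxchain_card)
  \<comment> \<open>Neither \<open>nat\<close> nor the subtraction truncates: a member of
    \<open>U\<close> has size between \<open>k + 1\<close> and \<open>b\<close>, so
    \<open>k < b\<close>.\<close>
  moreover have "int (b - k) - 1 = q - int k"
    using range \<open>U \<noteq> {}\<close> by (force simp: b_def)
  ultimately show ?thesis by (simp add: U_def)
qed

end
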